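(* Let $M_\#\in\mathbb{C}^{n\times n}$ be complex symmetric, $M_\#^T=M_\#$, and let $b\in\mathbb{C}^n$ be a unit vector. Let $U\in\mathbb{C}^{n\times n}$ be a unitary matrix such that $D_\#=U^*M_\#\overline{U}=\mathrm{diag}(\lambda_1,\ldots,\lambda_n)$ is diagonal and $r=U^*b\in\mathbb{R}^n$. Assume that $\lambda_1,\dots,\lambda_n$ are distinct, that among any three of the nonzero $\lambda_k$ at most two have the same modulus, that zero occurs at most once among the $\lambda_k$, and that all entries $r_1,\dots,r_n$ of $r$ are strictly positive. Then the complex symmetric Lanczos method applied to $M_\#\tau$ with starting vector $b$ does not break down before step $n$, so that it produces a complex symmetric tridiagonal matrix with diagonal entries $\alpha_1,\ldots,\alpha_n\in\mathbb{C}$ and off-diagonal entries $\beta_1,\ldots,\beta_{n-1}>0$. Moreover, the functions $p_0,\ldots,p_{n-1}$ defined by the three term recurrence $$p_0(\lambda)=1,\qquad \beta_1p_1(\lambda)=\lambda\overline{p_0(\lambda)}-\alpha_1p_0(\lambda),$$ $$\beta_kp_k(\lambda)=\lambda\overline{p_{k-1}(\lambda)}-\alpha_kp_{k-1}(\lambda)-\beta_{k-1}p_{k-2}(\lambda)\qquad(2\le k\le n-1)$$ are the result of orthonormalizing the monomials $1,\lambda,|\lambda|^2,\lambda|\lambda|^2,|\lambda|^4,\lambda|\lambda|^4,\ldots$ with respect to $\langle p,q\rangle=\sum_{k=1}^np(\lambda_k)\overline{q(\lambda_k)}\,r_k^2$; that is, $\mathrm{span}_{\mathbb{C}}\{p_0,\ldots,p_j\}=\mathcal{P}_j(r2)$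 for $0\le j\le n-1$, and $\langle p_k,p_l\rangle=\delta_{kl}$ for $0\le k,l\le n-1$.
   Context: A bar denotes (entrywise) complex conjugation and $\tau$ is the conjugation operator $\tau z=\overline{z}$ on $\mathbb{C}^n$, so $M_\#\tau z=M_\#\overline{z}$. For an integer $j\ge 0$, $\mathcal{P}_j(r2)$ is the complex vector space of functions of $\lambda\in\mathbb{C}$ of the form $\sum_{k=0}^{\lfloor j/2\rfloor}(\alpha_{2k}+\alpha_{2k+1}\lambda)|\lambda|^{2k}$ with $\alpha_k\in\mathbb{C}$, where $\alpha_{j+1}=0$ if $j$ is even. Complex symmetric Lanczos method for $M_\#\tau$ with unit starting vector $b$: set $q_1=b$, and for $k=1,2,\ldots$ put $\alpha_k=q_k^*M_\#\overline{q_k}$ and $w_k=M_\#\overline{q_k}-\alpha_kq_k-\beta_{k-1}q_{k-1}$ (the last term being absent for $k=1$), $\beta_k=\|w_k\|$ (Euclidean norm) and, if $\beta_k\neq0$, $q_{k+1}=w_k/\beta_k$. The method does not break down before step $n$ if $\beta_1,\ldots,\beta_{n-1}$ are all nonzero. *)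

theory Defs
  imports "HOL-Analysis.Analysis" "HOL-Library.Function_Algebras"
begin

definition conj_vec :: "complex^'n \<Rightarrow> complex^'n" where
  "conj_vec x = (\<chi> i. cnj (x $ i))"

definition conj_mat :: "complex^'n^'m \<Rightarrow> complex^'n^'m" where
  "conj_mat A = (\<chi> i j. cnj (A $ i $ j))"

definition adjoint_mat :: "complex^'n^'m \<Rightarrow> complex^'m^'n" where
  "adjoint_mat A = transpose (conj_mat A)"

definition unitary_mat :: "complex^'n^'n \<Rightarrow> bool" where
  "unitary_mat U \<longleftrightarrow> adjoint_mat U ** U = mat 1 \<and> U ** adjoint_mat U = mat 1"

definition diag_mat :: "('n \<Rightarrow> complex) \<Rightarrow> complex^'n^'n" where
  "diag_mat d = (\<chi> i j. if i = j then d i else 0)"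

text \<open>The product \<open>x\<^sup>* y\<close>, conjugate-linear in the first argument.\<close>
definition herm :: "complex^'n \<Rightarrow> complex^'n \<Rightarrow> complex" where
  "herm x y = (\<Sum>i\<in>UNIV. cnj (x $ i) * y $ i)"

text \<open>
  Complex symmetric Lanczos method for \<open>M\<tau>\<close>, indexed from 1 (the values at
  index 0 are dummies). The functions are total, with \<open>inverse 0 = 0\<close>, so the vectors are
  meaningful only up to the first \<open>k\<close> with \<open>lanczos_beta M b k = 0\<close>.
\<close>
function lanczos_q :: "complex^'n^'n \<Rightarrow> complex^'n \<Rightarrow> nat \<Rightarrow> complex^'n"
  and lanczos_w :: "complex^'n^'n \<Rightarrow> complex^'n \<Rightarrow> nat \<Rightarrow> complex^'n" where
  "lanczos_q M b 0 = 0"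
| "lanczos_q M b (Suc 0) = b"
| "lanczos_q M b (Suc (Suc k)) = lanczos_w M b (Suc k) /\<^sub>R norm (lanczos_w M b (Suc k))"
| "lanczos_w M b 0 = 0"
| "lanczos_w M b (Suc 0) =
     M *v conj_vec (lanczos_q M b (Suc 0))
     - herm (lanczos_q M b (Suc 0)) (M *v conj_vec (lanczos_q M b (Suc 0)))
         *s lanczos_q M b (Suc 0)"
| "lanczos_w M b (Suc (Suc k)) =
     M *v conj_vec (lanczos_q M b (Suc (Suc k)))
     - herm (lanczos_q M b (Suc (Suc k))) (M *v conj_vec (lanczos_q M b (Suc (Suc k))))
         *s lanczos_q M b (Suc (Suc k))
     - norm (lanczos_w M b (Suc k)) *\<^sub>R lanczos_q M b (Suc k)"
  by pat_completeness auto
termination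
  by (relation "Wellfounded.measure (\<lambda>x. case x of Inl (M, b, k) \<Rightarrow> 2 * k | Inr (M, b, k) \<Rightarrow> 2 * k + 1)") auto

definition lanczos_alpha :: "complex^'n^'n \<Rightarrow> complex^'n \<Rightarrow> nat \<Rightarrow> complex" where
  "lanczos_alpha M b k = herm (lanczos_q M b k) (M *v conj_vec (lanczos_q M b k))"

definition lanczos_beta :: "complex^'n^'n \<Rightarrow> complex^'n \<Rightarrow> nat \<Rightarrow> real" where
  "lanczos_beta M b k = norm (lanczos_w M b k)"

lemma lanczos_step:
  "lanczos_w M b (Suc (Suc k)) =
     M *v conj_vec (lanczos_q M b (Suc (Suc k)))
     - lanczos_alpha M b (Suc (Suc k)) *s lanczos_q M b (Suc (Suc k))
     - lanczos_beta M b (Suc k) *\<^sub>R lanczos_q M b (Suc k)"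
  "lanczos_q M b (Suc (Suc k)) = lanczos_w M b (Suc k) /\<^sub>R lanczos_beta M b (Suc k)"
  by (simp_all only: lanczos_q.simps(3) lanczos_w.simps(3) lanczos_alpha_def lanczos_beta_def)

definition no_breakdown_before :: "nat \<Rightarrow> complex^'n^'n \<Rightarrow> complex^'n \<Rightarrow> bool" where
  "no_breakdown_before m M b \<longleftrightarrow> (\<forall>k\<in>{1..<m}. lanczos_beta M b k \<noteq> 0)"

text \<open>
  The matrix assembled from the Lanczos coefficients. Only the entries with indices in
  \<open>{1..n}\<close> are relevant, where \<open>n\<close> is the size of \<open>M\<close>.
\<close>
definition lanczos_T :: "complex^'n^'n \<Rightarrow> complex^'n \<Rightarrow> nat \<Rightarrow> nat \<Rightarrow> complex" where
  "lanczos_T M b i j =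
     (if i = j then lanczos_alpha M b i
      else if j = Suc i then of_real (lanczos_beta M b i)
      else if i = Suc j then of_real (lanczos_beta M b j)
      else 0)"

definition symmetric_entries :: "nat \<Rightarrow> (nat \<Rightarrow> nat \<Rightarrow> complex) \<Rightarrow> bool" where
  "symmetric_entries n T \<longleftrightarrow> (\<forall>i\<in>{1..n}. \<forall>j\<in>{1..n}. T i j = T j i)"

definition tridiagonal_entries :: "nat \<Rightarrow> (nat \<Rightarrow> nat \<Rightarrow> complex) \<Rightarrow> bool" where
  "tridiagonal_entries n T \<longleftrightarrow>
     (\<forall>i\<in>{1..n}. \<forall>j\<in>{1..n}. Suc i < j \<or> Suc j < i \<longrightarrow> T i j = 0)"

text \<open>The recurrence solved for its left-hand side; it is equivalent to it when all \<open>be k\<close> are nonzero.\<close>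
fun recurrence_fun :: "(nat \<Rightarrow> complex) \<Rightarrow> (nat \<Rightarrow> real) \<Rightarrow> nat \<Rightarrow> complex \<Rightarrow> complex" where
  "recurrence_fun al be 0 z = 1"
| "recurrence_fun al be (Suc 0) z =
     (z * cnj (recurrence_fun al be 0 z) - al 1 * recurrence_fun al be 0 z) / of_real (be 1)"
| "recurrence_fun al be (Suc (Suc k)) z =
     (z * cnj (recurrence_fun al be (Suc k) z)
      - al (Suc (Suc k)) * recurrence_fun al be (Suc k) z
      - of_real (be (Suc k)) * recurrence_fun al be k z) / of_real (be (Suc (Suc k)))"

definition P_r2 :: "nat \<Rightarrow> (complex \<Rightarrow> complex) set" where
  "P_r2 j = {(\<lambda>z. \<Sum>k\<le>j div 2. (a (2*k) + a (2*k+1) * z) * of_real (norm z) ^ (2*k)) | a.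
               even j \<longrightarrow> a (j+1) = 0}"

definition cfun_scale :: "complex \<Rightarrow> (complex \<Rightarrow> complex) \<Rightarrow> complex \<Rightarrow> complex" where
  "cfun_scale c f = (\<lambda>z. c * f z)"

global_interpretation cfun: vector_space cfun_scale
  by standard (auto simp: cfun_scale_def fun_eq_iff algebra_simps)

definition discrete_inner ::
  "('n::finite \<Rightarrow> complex) \<Rightarrow> ('n \<Rightarrow> real) \<Rightarrow> (complex \<Rightarrow> complex) \<Rightarrow> (complex \<Rightarrow> complex) \<Rightarrow> complex"
  where
  "discrete_inner lam r p q = (\<Sum>k\<in>UNIV. p (lam k) * cnj (q (lam k)) * of_real ((r k)\<^sup>2))"

end

theory Submission
  imports Defs "HOL-Computational_Algebra.Polynomial"
begin

text \<open>
  The map \<open>f \<mapsto> U (f(\<lambda>\<^sub>k) r\<^sub>k)\<^sub>k\<close> carries \<open>z \<cdot> cnj f\<close> to \<open>M\<tau>\<close> applied to the image of \<open>f\<close> and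
  turns the discrete inner product into the Hermitian one, so it sends the recurrence
  functions \<open>p\<^sub>k\<close> to the Lanczos vectors \<open>q\<^sub>k\<^sub>+\<^sub>1\<close>. Breakdown before step \<open>n\<close> would give a nonzero
  \<open>f(z) = A(|z|\<^sup>2) + B(|z|\<^sup>2) z\<close> in the span of the first \<open>n\<close> monomials vanishing at all \<open>\<lambda>\<^sub>k\<close>.
  With \<open>*\<close> conjugating coefficients, \<open>F = A A* - t B B*\<close> is then a polynomial of degree less
  than \<open>n\<close>, nonzero because its two terms have degrees of different parity. It vanishes at
  every \<open>|\<lambda>\<^sub>k|\<^sup>2\<close>, and doubly where two of the \<open>\<lambda>\<^sub>k\<close> share their modulus, because there both \<open>A\<close>
  and \<open>B\<close> vanish. So it has at least \<open>n\<close> roots, a contradiction.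
\<close>

section \<open>Counting roots of the auxiliary polynomial in the squared modulus\<close>

lemma of_real_cmod_square: "(complex_of_real (cmod z))\<^sup>2 = z * cnj z"
  by (metis complex_norm_square of_real_power)

lemma poly_map_cnj_of_real: "poly (map_poly cnj A) (of_real t) = cnj (poly A (of_real t))"
  by (induction A) (auto simp: map_poly_pCons)

lemma degree_map_poly_cnj [simp]: "degree (map_poly cnj A) = degree A"
  by (rule degree_map_poly) auto

lemma map_poly_cnj_eq_0_iff [simp]: "map_poly cnj A = 0 \<longleftrightarrow> A = 0"
  by (metis complex_cnj_zero complex_cnj_zero_iff map_poly_0 map_poly_eq_0_iff)

text \<open>Assumption \<open>three\<close> speaks only of nonzero values. Two distinct indices
  sharing the squared modulus \<open>t\<close> already force \<open>t\<close> to be nonzero, since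
  \<open>lam\<close> is injective and takes the value 0 at most once; so \<open>three\<close>
  applies to any three of them.\<close>

lemma card_equal_moduli_le_2:
  fixes lam :: "'n::finite \<Rightarrow> complex"
  assumes inj: "inj lam"
    and three: "\<And>i j k. \<lbrakk>i \<noteq> j; j \<noteq> k; i \<noteq> k; lam i \<noteq> 0; lam j \<noteq> 0; lam k \<noteq> 0\<rbrakk>
           \<Longrightarrow> \<not> (norm (lam i) = norm (lam j) \<and> norm (lam j) = norm (lam k))"
  shows "card {k. complex_of_real ((norm (lam k))\<^sup>2) = t} \<le> 2"
proof -
  let ?S = "{k. complex_of_real ((norm (lam k))\<^sup>2) = t}"
  have nz: "t \<noteq> 0" if "i \<noteq> j" "complex_of_real ((norm (lam i))\<^sup>2) = t" "complex_of_real ((norm (lam j))\<^sup>2) = t" for i j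
    using that inj by (auto simp: inj_def)
  have eq: "norm (lam i) = norm (lam j)" if "i \<in> ?S" "j \<in> ?S" for i j
  proof -
    have "complex_of_real ((norm (lam i))\<^sup>2) = complex_of_real ((norm (lam j))\<^sup>2)"
      using that by simp
    then have "(norm (lam i))\<^sup>2 = (norm (lam j))\<^sup>2"
      unfolding of_real_eq_iff .
    then show ?thesis by simp
  qed
  show "card ?S \<le> 2"
  proof (rule ccontr)
    assume "\<not> card ?S \<le> 2"
    then obtain B where B: "B \<subseteq> ?S" "card B = 3"
      by (metis not_less_eq_eq numeral_3_eq_3 numeral_2_eq_2 obtain_subset_with_card_n)
    then obtain i j k where ijk: "B = {i, j, k}" "i \<noteq> j" "j \<noteq> k" "i \<noteq> k"
      by (auto simp: card_3_iff)
    then have m: "i \<in> ?S" "j \<in> ?S" "k \<in> ?S" using B by auto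
    then have "t \<noteq> 0" using nz[of i j] ijk by auto
    then have "lam i \<noteq> 0" "lam j \<noteq> 0" "lam k \<noteq> 0" using m by auto
    then show False using three[of i j k] ijk eq m by metis
  qed
qed

lemma not_all_roots:
  fixes lam :: "'n::finite \<Rightarrow> complex" and A B :: "complex poly"
  assumes inj: "inj lam"
    and three: "\<And>i j k. \<lbrakk>i \<noteq> j; j \<noteq> k; i \<noteq> k; lam i \<noteq> 0; lam j \<noteq> 0; lam k \<noteq> 0\<rbrakk>
           \<Longrightarrow> \<not> (norm (lam i) = norm (lam j) \<and> norm (lam j) = norm (lam k))"
    and nz: "A \<noteq> 0 \<or> B \<noteq> 0"
    and dA: "A \<noteq> 0 \<Longrightarrow> 2 * degree A < CARD('n)"
    and dB: "B \<noteq> 0 \<Longrightarrow> 2 * degree B + 1 < CARD('n)"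
    and root: "\<And>k. poly A (of_real ((norm (lam k))\<^sup>2)) + poly B (of_real ((norm (lam k))\<^sup>2)) * lam k = 0"
  shows False
proof -
  \<comment> \<open>\<open>pCons 0\<close> multiplies by the variable. At the real point
    \<open>t k = lam k * cnj (lam k)\<close> the two products become the squared moduli of
    \<open>A\<close> and of \<open>B * lam k\<close>, which agree because
    \<open>A = - B * lam k\<close> there.\<close>
  define F where "F = A * map_poly cnj A - pCons 0 (B * map_poly cnj B)"
  define t where "t = (\<lambda>k. complex_of_real ((norm (lam k))\<^sup>2))"
  have dA2: "degree (A * map_poly cnj A) = 2 * degree A"
    by (cases "A = 0") (auto simp: degree_mult_eq)
  have dB2: "degree (pCons 0 (B * map_poly cnj B)) = 2 * degree B + 1" if "B \<noteq> 0"
    using that by (auto simp: degree_mult_eq)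
  have F: "F \<noteq> 0 \<and> degree F < CARD('n)"
  proof -
    consider "B = 0" | "A = 0" "B \<noteq> 0" | "A \<noteq> 0" "B \<noteq> 0" by blast
    then show ?thesis
    proof cases
      case 1
      then show ?thesis using nz dA dA2 by (auto simp: F_def)
    next
      case 2
      then show ?thesis using dB dB2 by (auto simp: F_def)
    next
      case 3
      have "degree (A * map_poly cnj A) \<noteq> degree (pCons 0 (B * map_poly cnj B))"
        unfolding dA2 dB2[OF 3(2)] by presburger
      then have "F \<noteq> 0" unfolding F_def by (metis right_minus_eq)
      moreover have "degree F < CARD('n)"
        unfolding F_def using dA dB dA2 dB2 3 by (intro degree_diff_less) auto
      ultimately show ?thesis by simp
    qed
  qed
  have cnj_poly: "poly (map_poly cnj P) (t k) = cnj (poly P (t k))" for P k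
    unfolding t_def by (rule poly_map_cnj_of_real)
  have F0: "poly F (t k) = 0" for k
  proof -
    have A: "poly A (t k) = - (poly B (t k) * lam k)"
      using root[of k] by (simp add: t_def eq_neg_iff_add_eq_0)
    have "t k = lam k * cnj (lam k)" by (simp add: t_def of_real_cmod_square)
    then have "t k * (poly B (t k) * cnj (poly B (t k)))
        = (lam k * cnj (lam k)) * (poly B (t k) * cnj (poly B (t k)))" by (rule arg_cong)
    also have "\<dots> = poly A (t k) * cnj (poly A (t k))"
      unfolding A complex_cnj_minus complex_cnj_mult by (simp only: minus_mult_minus mult_ac)
    finally show ?thesis
      by (simp only: F_def poly_diff poly_mult poly_pCons cnj_poly add_0 diff_self)
  qed
  have order: "card {k. t k = s} \<le> order s F" for s
  proof -
    have c2: "card {k. t k = s} \<le> 2"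
      unfolding t_def using card_equal_moduli_le_2[of lam] inj three by blast
    consider "card {k. t k = s} = 0" | "card {k. t k = s} = 1" | "card {k. t k = s} = 2"
      using c2 by linarith
    then show ?thesis
    proof cases
      case 2
      then obtain k where "t k = s" by (auto simp: card_1_singleton_iff)
      then have "order s F \<noteq> 0" using F0[of k] F by (simp add: order_root)
      then show ?thesis using 2 by simp
    next
      case 3
      then obtain i j where ij: "i \<noteq> j" "t i = s" "t j = s"
        by (auto simp: card_2_iff)
      have eqs: "poly A s + poly B s * lam i = 0" "poly A s + poly B s * lam j = 0"
        using root[of i] root[of j] ij by (auto simp: t_def)
      \<comment> \<open>Subtracting the two relations eliminates \<open>A\<close>; injectivity then
        allows division by \<open>lam i - lam j\<close>.\<close>
      have "poly B s * (lam i - lam j) = (poly A s + poly B s * lam i) - (poly A s + poly B s * lam j)"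
        by (simp add: right_diff_distrib)
      then have "poly B s * (lam i - lam j) = 0" unfolding eqs by simp
      then have B0: "poly B s = 0" using inj ij by (auto simp: inj_def)
      then have A0: "poly A s = 0" using eqs by simp
      \<comment> \<open>Since \<open>s = t i\<close> is real, the polynomials with conjugated
        coefficients vanish at \<open>s\<close> as well.\<close>
      have d: "[:- s, 1:] dvd A" "[:- s, 1:] dvd B" 
        "[:- s, 1:] dvd map_poly cnj A" "[:- s, 1:] dvd map_poly cnj B"
        using A0 B0 cnj_poly[of _ i] ij by (auto simp: poly_eq_0_iff_dvd[symmetric])
      have "[:- s, 1:] ^ 2 dvd F"
        unfolding F_def power2_eq_square
      proof (rule dvd_diff)
        show "[:- s, 1:] * [:- s, 1:] dvd A * map_poly cnj A"
          using d by (intro mult_dvd_mono)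
        have "[:- s, 1:] * [:- s, 1:] dvd [:0, 1:] * (B * map_poly cnj B)"
          using d by (intro dvd_mult mult_dvd_mono)
        then show "[:- s, 1:] * [:- s, 1:] dvd pCons 0 (B * map_poly cnj B)"
          by simp
      qed
      then show ?thesis using F 3 by (simp add: order_divides)
    qed simp
  qed
  \<comment> \<open>Taking the values \<open>t k\<close> as a multiset of size \<open>n\<close>
    turns the pointwise bounds on the order into a bound on the number of roots with
    multiplicity.\<close>
  have "image_mset t (mset_set UNIV) \<subseteq># proots F"
  proof (rule mset_subset_eqI)
    fix s
    have "count (image_mset t (mset_set UNIV)) s = card {k. t k = s}"
      by (simp add: count_image_mset vimage_def)
    then show "count (image_mset t (mset_set UNIV)) s \<le> count (proots F) s"
      using order[of s] F by simp
  qed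
  then have "CARD('n) \<le> size (proots F)"
    by (auto dest: size_mset_mono)
  also have "\<dots> \<le> degree F" by (rule size_proots_le)
  finally show False using F by simp
qed

section \<open>The ordered monomials and their linear combinations\<close>

definition r2_monomial :: "nat \<Rightarrow> complex \<Rightarrow> complex" where
  "r2_monomial i z = (if even i then 1 else z) * of_real (norm z) ^ (2 * (i div 2))"

lemma r2_monomial_even [simp]: "r2_monomial (2 * i) z = of_real (norm z) ^ (2 * i)"
  and r2_monomial_odd [simp]: "r2_monomial (Suc (2 * i)) z = z * of_real (norm z) ^ (2 * i)"
  by (auto simp: r2_monomial_def)

text \<open>Conjugation fixes the even monomials and turns the factor \<open>z\<close> of an odd one
  into \<open>cnj z\<close>, which the new \<open>z\<close> completes to the squared modulus. Hence
  the listed order is the Krylov sequence of the antilinear map \<open>f\<close> to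
  \<open>z * cnj f\<close>, started at 1.\<close>

lemma r2_monomial_Suc: "z * cnj (r2_monomial i z) = r2_monomial (Suc i) z"
proof (cases "even i")
  case True
  then obtain m where "i = 2 * m" by blast
  then show ?thesis by simp
next
  case False
  then obtain m where m: "i = Suc (2 * m)" by (metis oddE Suc_eq_plus1)
  have "z * cnj z = of_real (norm z) ^ 2" by (simp add: of_real_cmod_square)
  moreover have "Suc i = 2 * Suc m" by (simp add: m)
  ultimately show ?thesis unfolding m
    by (simp only: r2_monomial_even r2_monomial_odd \<open>Suc i = 2 * Suc m\<close>[unfolded m])
      (simp add: power_add[symmetric] mult.assoc[symmetric])
qed

definition r2_comb :: "nat \<Rightarrow> (nat \<Rightarrow> complex) \<Rightarrow> complex \<Rightarrow> complex" where
  "r2_comb j c z = (\<Sum>i<j. c i * r2_monomial i z)"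

lemma sum_pairs: "(\<Sum>i<2 * m. f i) = (\<Sum>k<m. f (2 * k) + f (Suc (2 * k)))"
  for f :: "nat \<Rightarrow> 'a::comm_monoid_add"
  by (induction m) (auto simp: add.assoc)

text \<open>Padding with zero coefficients to the even length \<open>2 * m\<close> lets each even
  term pair with the odd term after it.\<close>

lemma r2_comb_poly:
  assumes "j \<le> 2 * m" "\<And>i. j \<le> i \<Longrightarrow> c i = 0"
  shows "r2_comb j c z = (\<Sum>k<m. (c (2*k) + c (2*k+1) * z) * of_real (norm z) ^ (2*k))"
proof -
  have "r2_comb j c z = (\<Sum>i<2*m. c i * r2_monomial i z)"
    unfolding r2_comb_def using assms by (intro sum.mono_neutral_left) auto
  also have "\<dots> = (\<Sum>k<m. (c (2*k) + c (2*k+1) * z) * of_real (norm z) ^ (2*k))"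
    unfolding sum_pairs by (intro sum.cong) (simp_all add: distrib_right mult.assoc)
  finally show ?thesis .
qed

lemma r2_comb_cong: "(\<And>i. i < j \<Longrightarrow> c i = d i) \<Longrightarrow> r2_comb j c = r2_comb j d"
  by (auto simp: r2_comb_def fun_eq_iff)

lemma r2_comb_not_all_roots:
  fixes lam :: "'n::finite \<Rightarrow> complex"
  assumes inj: "inj lam"
    and three: "\<And>i j k. \<lbrakk>i \<noteq> j; j \<noteq> k; i \<noteq> k; lam i \<noteq> 0; lam j \<noteq> 0; lam k \<noteq> 0\<rbrakk>
           \<Longrightarrow> \<not> (norm (lam i) = norm (lam j) \<and> norm (lam j) = norm (lam k))"
    and j: "j \<le> CARD('n)" and i: "i < j" "c i \<noteq> 0"
  shows "\<exists>k. r2_comb j c (lam k) \<noteq> 0"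
proof (rule ccontr)
  assume "\<not> ?thesis"
  then have zero: "r2_comb j c (lam k) = 0" for k by simp
  \<comment> \<open>\<open>A\<close> and \<open>B\<close> below collect the even and the odd
    coefficients over \<open>k < j\<close>, which reaches past index \<open>j\<close>; truncation
    makes those extra coefficients zero and yields the degree bounds.\<close>
  define c' where "c' = (\<lambda>i. if i < j then c i else 0)"
  have c': "r2_comb j c = r2_comb j c'" by (rule r2_comb_cong) (simp add: c'_def)
  define A where "A = (\<Sum>k<j. monom (c' (2*k)) k)"
  define B where "B = (\<Sum>k<j. monom (c' (2*k+1)) k)"
  have coeffA: "coeff A k = c' (2*k)" and coeffB: "coeff B k = c' (2*k+1)" for k
    by (auto simp: A_def B_def coeff_sum c'_def)
  have "2 * degree A < j" if "A \<noteq> 0"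
    using that coeffA[of "degree A"] by (auto simp: c'_def split: if_splits)
  moreover have "2 * degree B + 1 < j" if "B \<noteq> 0"
    using that coeffB[of "degree B"] by (auto simp: c'_def split: if_splits)
  moreover have "A \<noteq> 0 \<or> B \<noteq> 0"
  proof (cases "even i")
    case True
    then have "coeff A (i div 2) \<noteq> 0" using i by (simp add: coeffA c'_def)
    then show ?thesis by auto
  next
    case False
    then have "coeff B (i div 2) \<noteq> 0" using i by (simp add: coeffB c'_def)
    then show ?thesis by auto
  qed
  moreover have "poly A (of_real ((norm (lam k))\<^sup>2)) + poly B (of_real ((norm (lam k))\<^sup>2)) * lam k = 0" for k
  proof -
    define T where "T = complex_of_real ((norm (lam k))\<^sup>2)"
    have T: "of_real (norm (lam k)) ^ (2 * i) = T ^ i" for i by (simp add: T_def power_mult)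
    have "r2_comb j c' (lam k) = (\<Sum>i<j. (c' (2*i) + c' (2*i+1) * lam k) * T ^ i)"
      unfolding T[symmetric] by (rule r2_comb_poly) (auto simp: c'_def)
    also have "\<dots> = poly A T + poly B T * lam k"
      unfolding A_def B_def poly_sum poly_monom sum_distrib_right sum.distrib[symmetric]
      by (intro sum.cong) (auto simp: algebra_simps)
    finally show ?thesis using zero[of k] unfolding c' T_def by simp
  qed
  ultimately show False
    using not_all_roots[OF inj three, of A B] j by force
qed

text \<open>The paired sum ends at index \<open>j\<close> for odd \<open>j\<close> and at
  \<open>j + 1\<close> for even \<open>j\<close>; the parity condition removes just that surplus
  coefficient.\<close>

lemma P_r2_eq: "P_r2 j = range (r2_comb (Suc j))"
proof (intro subset_antisym subsetI)
  fix f assume "f \<in> P_r2 j"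
  then obtain a where f: "f = (\<lambda>z. \<Sum>k\<le>j div 2. (a (2*k) + a (2*k+1) * z) * of_real (norm z) ^ (2*k))"
    and a: "even j \<longrightarrow> a (j+1) = 0"
    unfolding P_r2_def by blast
  define c where "c = (\<lambda>i. if i < Suc j then a i else 0)"
  have "f = r2_comb (Suc j) c"
  proof
    fix z
    have "r2_comb (Suc j) c z
      = (\<Sum>k<Suc (j div 2). (c (2*k) + c (2*k+1) * z) * of_real (norm z) ^ (2*k))"
      by (rule r2_comb_poly) (auto simp: c_def)
    also have "\<dots> = f z"
      unfolding f lessThan_Suc_atMost
    proof (intro sum.cong refl)
      fix k assume k: "k \<in> {..j div 2}"
      have "c (2*k) = a (2*k)" using k by (auto simp: c_def)
      moreover have "c (2*k+1) = a (2*k+1)"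
      \<comment> \<open>The only index out of range is \<open>j + 1\<close>, reached for even
        \<open>j\<close> at the last \<open>k\<close>.\<close>
      proof (cases "2*k+1 < Suc j")
        case False
        then have "2 * k = j" using k by auto
        then show ?thesis using a by (auto simp: c_def)
      qed (simp add: c_def)
      ultimately show "(c (2*k) + c (2*k+1) * z) * complex_of_real (norm z) ^ (2*k)
        = (a (2*k) + a (2*k+1) * z) * of_real (norm z) ^ (2*k)" by simp
    qed
    finally show "f z = r2_comb (Suc j) c z" ..
  qed
  then show "f \<in> range (r2_comb (Suc j))" by blast
next
  fix f assume "f \<in> range (r2_comb (Suc j))"
  then obtain c where f: "f = r2_comb (Suc j) c" by blast
  define a where "a = (\<lambda>i. if i < Suc j then c i else 0)"
  have "f = r2_comb (Suc j) a" unfolding f by (rule r2_comb_cong) (simp add: a_def)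
  also have "\<dots> = (\<lambda>z. \<Sum>k\<le>j div 2. (a (2*k) + a (2*k+1) * z) * of_real (norm z) ^ (2*k))"
    unfolding lessThan_Suc_atMost[symmetric]
    by (rule ext, rule r2_comb_poly) (auto simp: a_def)
  finally show "f \<in> P_r2 j"
    using a_def unfolding P_r2_def by (intro CollectI exI[of _ a]) simp
qed

lemma r2_comb_mem_span: "r2_comb j c \<in> cfun.span (r2_monomial ` {..<j})"
proof -
  have "r2_comb j c = (\<Sum>i<j. cfun_scale (c i) (r2_monomial i))"
  proof
    fix z
    have "(\<Sum>i<j. cfun_scale (c i) (r2_monomial i)) z = (\<Sum>i<j. c i * r2_monomial i z)"
      by (induction j) (auto simp: cfun_scale_def)
    then show "r2_comb j c z = (\<Sum>i<j. cfun_scale (c i) (r2_monomial i)) z"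
      by (simp add: r2_comb_def)
  qed
  also have "\<dots> \<in> cfun.span (r2_monomial ` {..<j})"
    by (intro cfun.span_sum cfun.span_scale cfun.span_base) auto
  finally show ?thesis .
qed

lemma r2_comb_add: "r2_comb j c + r2_comb j d = r2_comb j (\<lambda>i. c i + d i)"
  and r2_comb_scale: "cfun_scale a (r2_comb j c) = r2_comb j (\<lambda>i. a * c i)"
  by (auto simp: r2_comb_def fun_eq_iff cfun_scale_def sum.distrib sum_distrib_left algebra_simps)

lemma r2_comb_extend:
  assumes "j \<le> m"
  shows "r2_comb j c = r2_comb m (\<lambda>i. if i < j then c i else 0)"
  unfolding r2_comb_def using assms
  by (intro ext sum.mono_neutral_cong_left) auto

lemma r2_comb_Suc: "r2_comb (Suc j) c = r2_comb j c + cfun_scale (c j) (r2_monomial j)"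
  by (auto simp: r2_comb_def cfun_scale_def)

text \<open>By \<open>r2_monomial_Suc\<close> the coefficients are conjugated and shifted up by one,
  so a nonzero leading coefficient stays nonzero.\<close>

lemma r2_comb_cnj: "z * cnj (r2_comb j c z) = r2_comb (Suc j) (case_nat 0 (\<lambda>i. cnj (c i))) z"
  unfolding r2_comb_def sum.lessThan_Suc_shift
  by (simp add: sum_distrib_left r2_monomial_Suc[symmetric] mult_ac)

lemma span_r2_monomial: "cfun.span (r2_monomial ` {..<j}) = range (r2_comb j)"
proof
  show "range (r2_comb j) \<subseteq> cfun.span (r2_monomial ` {..<j})"
    using r2_comb_mem_span by blast
  show "cfun.span (r2_monomial ` {..<j}) \<subseteq> range (r2_comb j)"
  proof (rule cfun.span_minimal)
    show "r2_monomial ` {..<j} \<subseteq> range (r2_comb j)"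
    proof (rule image_subsetI)
      fix i assume "i \<in> {..<j}"
      then have "r2_monomial i = r2_comb j (\<lambda>l. if l = i then 1 else 0)"
        by (auto simp: r2_comb_def fun_eq_iff if_distrib[of "\<lambda>x. x * _"] sum.delta cong: if_cong)
      then show "r2_monomial i \<in> range (r2_comb j)" by blast
    qed
    show "cfun.subspace (range (r2_comb j))"
      unfolding cfun.subspace_def
    proof (intro conjI ballI allI)
      have "0 = r2_comb j (\<lambda>_. 0)" by (auto simp: r2_comb_def fun_eq_iff)
      then show "0 \<in> range (r2_comb j)" by blast
    qed (auto simp: r2_comb_add r2_comb_scale)
  qed
qed

section \<open>Triangular change of basis and the recurrence functions\<close>

lemma span_insert_leading:
  assumes "u \<in> cfun.span A" "c \<noteq> 0"
  shows "cfun.span (insert (u + cfun_scale c y) A) = cfun.span (insert y A)"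
proof (rule cfun.span_eq[THEN iffD2], intro conjI insert_subsetI)
  show "u + cfun_scale c y \<in> cfun.span (insert y A)"
    using assms(1) cfun.span_mono[of A "insert y A"]
    by (intro cfun.span_add cfun.span_scale cfun.span_base[of y]) auto
  have "cfun_scale (inverse c) ((u + cfun_scale c y) - u) \<in> cfun.span (insert (u + cfun_scale c y) A)"
    using assms(1) cfun.span_mono[of A "insert (u + cfun_scale c y) A"]
    by (intro cfun.span_diff cfun.span_scale cfun.span_base[of "u + cfun_scale c y"]) auto
  also have "cfun_scale (inverse c) ((u + cfun_scale c y) - u) = y"
    using assms(2) by (auto simp: cfun_scale_def fun_eq_iff)
  finally show "y \<in> cfun.span (insert (u + cfun_scale c y) A)" .
qed (auto intro: cfun.span_base)

text \<open>Modulo the span of the earlier monomials, \<open>p k\<close> is a nonzero multiple of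
  the monomial number \<open>k\<close>, so one may replace the other as a generator.\<close>

lemma span_triangular:
  assumes "\<And>k. k < j \<Longrightarrow> \<exists>c. c k \<noteq> 0 \<and> p k = r2_comb (Suc k) c"
  shows "cfun.span (p ` {..<j}) = cfun.span (r2_monomial ` {..<j})"
  using assms
proof (induction j)
  case (Suc j)
  obtain c where c: "c j \<noteq> 0" "p j = r2_comb (Suc j) c" using Suc.prems[of j] by auto
  have IH: "cfun.span (p ` {..<j}) = cfun.span (r2_monomial ` {..<j})"
    using Suc by simp
  have "cfun.span (p ` {..<Suc j}) = cfun.span (insert (p j) (r2_monomial ` {..<j}))"
    using IH by (simp add: lessThan_Suc cfun.span_insert)
  also have "\<dots> = cfun.span (insert (r2_monomial j) (r2_monomial ` {..<j}))"
    unfolding c(2) r2_comb_Suc by (intro span_insert_leading r2_comb_mem_span c)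
  finally show ?case by (simp add: lessThan_Suc)
qed simp

text \<open>The counterpart of the unnormalized Lanczos vector with index \<open>Suc k\<close>. It
  is kept apart from the division by \<open>be (Suc k)\<close> because it must be shown nonzero
  before that division is meaningful.\<close>

definition recurrence_num :: "(nat \<Rightarrow> complex) \<Rightarrow> (nat \<Rightarrow> real) \<Rightarrow> nat \<Rightarrow> complex \<Rightarrow> complex" where
  "recurrence_num al be k z = z * cnj (recurrence_fun al be k z) - al (Suc k) * recurrence_fun al be k z
     - (case k of 0 \<Rightarrow> 0 | Suc j \<Rightarrow> of_real (be k) * recurrence_fun al be j z)"

lemma recurrence_fun_Suc: 
  "recurrence_fun al be (Suc k) z = recurrence_num al be k z / of_real (be (Suc k))"
  by (cases k) (auto simp: recurrence_num_def)

text \<open>Only \<open>z * cnj (p k z)\<close> reaches the monomial number \<open>Suc k\<close>;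
  the two subtracted terms are combinations of earlier monomials.\<close>

lemma recurrence_num_leading:
  assumes p: "\<exists>c. c k \<noteq> 0 \<and> recurrence_fun al be k = r2_comb (Suc k) c"
    and prev: "\<And>i. k = Suc i \<Longrightarrow> \<exists>d. recurrence_fun al be i = r2_comb (Suc i) d"
  shows "\<exists>c. c (Suc k) \<noteq> 0 \<and> recurrence_num al be k = r2_comb (Suc (Suc k)) c"
proof -
  let ?p = "recurrence_fun al be"
  obtain c where c: "c k \<noteq> 0" "?p k = r2_comb (Suc k) c" using p by blast
  have "\<exists>d. \<forall>z. (case k of 0 \<Rightarrow> 0 | Suc j \<Rightarrow> of_real (be k) * ?p j z) = r2_comb (Suc k) d z"
  proof (cases k)
    case 0
    then show ?thesis by (intro exI[of _ "\<lambda>_. 0"]) (simp add: r2_comb_def)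
  next
    case (Suc j)
    then obtain d where d: "?p j = r2_comb (Suc j) d" using prev by blast
    have "cfun_scale (be k) (?p j) = r2_comb (Suc k) (\<lambda>i. if i < Suc j then be k * d i else 0)"
      unfolding d r2_comb_scale using Suc by (intro r2_comb_extend) simp
    then show ?thesis using Suc by (auto simp: cfun_scale_def fun_eq_iff)
  qed
  then obtain d where d: "\<And>z. (case k of 0 \<Rightarrow> 0 | Suc j \<Rightarrow> of_real (be k) * ?p j z) = r2_comb (Suc k) d z"
    by blast
  \<comment> \<open>The subtracted part is padded by a zero at index \<open>Suc k\<close>, so
    \<open>e (Suc k) = cnj (c k)\<close>.\<close>
  define e where "e = (\<lambda>i. (case_nat 0 (\<lambda>i. cnj (c i)) i) - (if i < Suc k then al (Suc k) * c i + d i else 0))"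
  have "recurrence_num al be k z = r2_comb (Suc (Suc k)) e z" for z
  proof -
    have ext: "r2_comb (Suc k) f z = r2_comb (Suc (Suc k)) (\<lambda>i. if i < Suc k then f i else 0) z" for f
      using r2_comb_extend[of "Suc k" "Suc (Suc k)" f] by simp
    have "recurrence_num al be k z = r2_comb (Suc (Suc k)) (case_nat 0 (\<lambda>i. cnj (c i))) z
      - r2_comb (Suc k) (\<lambda>i. al (Suc k) * c i + d i) z"
      unfolding recurrence_num_def d c(2) r2_comb_cnj
      by (simp only: r2_comb_def distrib_right sum.distrib sum_distrib_left mult.assoc diff_diff_eq)
    also have "\<dots> = r2_comb (Suc (Suc k)) e z"
      unfolding ext e_def by (simp only: r2_comb_def left_diff_distrib sum_subtractf)
    finally show ?thesis .
  qed
  moreover have "e (Suc k) \<noteq> 0" using c by (simp add: e_def)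
  ultimately show ?thesis by blast
qed

lemma recurrence_fun_leading:
  assumes "\<And>i. 1 \<le> i \<Longrightarrow> i \<le> k \<Longrightarrow> be i \<noteq> 0"
  shows "\<exists>c. c k \<noteq> 0 \<and> recurrence_fun al be k = r2_comb (Suc k) c"
  using assms
proof (induction k rule: less_induct)
  case (less k)
  show ?case
  proof (cases k)
    case 0
    have "recurrence_fun al be 0 = r2_comb (Suc 0) (\<lambda>_. 1)"
      by (auto simp: r2_comb_def r2_monomial_def fun_eq_iff)
    then show ?thesis unfolding 0 by (intro exI[of _ "\<lambda>_. 1"]) simp
  next
    case (Suc m)
    have IH: "\<exists>c. c i \<noteq> 0 \<and> recurrence_fun al be i = r2_comb (Suc i) c" if "i \<le> m" for i
      using less.IH[of i] less.prems that Suc by auto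
    have "\<exists>c. c (Suc m) \<noteq> 0 \<and> recurrence_num al be m = r2_comb (Suc (Suc m)) c"
    proof (rule recurrence_num_leading)
      show "\<exists>d. recurrence_fun al be i = r2_comb (Suc i) d" if "m = Suc i" for i
        using IH[of i] that by auto
    qed (use IH in simp)
    then obtain c where c: "c (Suc m) \<noteq> 0" "recurrence_num al be m = r2_comb (Suc (Suc m)) c"
      by blast
    have "recurrence_fun al be (Suc m) = cfun_scale (inverse (be (Suc m))) (recurrence_num al be m)"
      by (auto simp: fun_eq_iff recurrence_fun_Suc cfun_scale_def field_simps)
    then have "recurrence_fun al be (Suc m) = r2_comb (Suc (Suc m)) (\<lambda>i. inverse (be (Suc m)) * c i)"
      unfolding c r2_comb_scale .
    moreover have "inverse (be (Suc m)) * c (Suc m) \<noteq> 0" using c less.prems Suc by auto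
    ultimately show ?thesis unfolding Suc by (intro exI conjI)
  qed
qed

section \<open>Transport between functions on the spectrum and vectors\<close>

definition sampled_vec :: "complex^'n^'n \<Rightarrow> ('n \<Rightarrow> complex) \<Rightarrow> ('n \<Rightarrow> real) \<Rightarrow> (complex \<Rightarrow> complex) \<Rightarrow> complex^'n" where
  "sampled_vec U lam r f = U *v (\<chi> i. f (lam i) * of_real (r i))"

lemma conj_vec_mult: "conj_vec (A *v x) = conj_mat A *v conj_vec x"
  by (auto simp: conj_vec_def conj_mat_def matrix_vector_mult_def vec_eq_iff)

lemma herm_adjoint: "herm (A *v x) y = herm x (adjoint_mat A *v y)"
proof -
  have "herm (A *v x) y = (\<Sum>i\<in>UNIV. \<Sum>j\<in>UNIV. cnj (A $ i $ j) * cnj (x $ j) * y $ i)"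
    by (simp add: herm_def matrix_vector_mult_def sum_distrib_right)
  also have "\<dots> = (\<Sum>j\<in>UNIV. \<Sum>i\<in>UNIV. cnj (A $ i $ j) * cnj (x $ j) * y $ i)"
    by (rule sum.swap)
  also have "\<dots> = herm x (adjoint_mat A *v y)"
    by (simp add: herm_def matrix_vector_mult_def adjoint_mat_def conj_mat_def transpose_def
        sum_distrib_left mult_ac)
  finally show ?thesis .
qed

lemma herm_self: "herm x x = of_real ((norm x)\<^sup>2)"
proof -
  have "of_real ((norm x)\<^sup>2) = (\<Sum>i\<in>UNIV. (of_real (norm (x $ i)))\<^sup>2 :: complex)"
    by (simp add: norm_vec_def L2_set_def sum_nonneg)
  also have "\<dots> = herm x x"
    unfolding herm_def by (intro sum.cong refl) (simp add: of_real_cmod_square mult.commute)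
  finally show ?thesis ..
qed

context
  fixes M U :: "complex^'n^'n" and b :: "complex^'n"
    and lam :: "'n \<Rightarrow> complex" and r :: "'n \<Rightarrow> real"
  assumes U: "unitary_mat U"
    and D: "adjoint_mat U ** M ** conj_mat U = diag_mat lam"
    and b: "adjoint_mat U *v b = (\<chi> k. of_real (r k))"
begin

private abbreviation (input) "V \<equiv> sampled_vec U lam r"

text \<open>\<open>U\<close> preserves \<open>herm\<close>. The arguments swap because
  \<open>herm\<close> is conjugate-linear in its first argument and \<open>discrete_inner\<close> in
  its second.\<close>

lemma herm_sampled: "herm (V f) (V g) = discrete_inner lam r g f"
proof -
  have "adjoint_mat U *v (U *v x) = x" for x :: "complex^'n"
    using U by (simp add: unitary_mat_def matrix_vector_mul_assoc)
  then have "herm (V f) (V g) = herm (\<chi> i. f (lam i) * of_real (r i)) (\<chi> i. g (lam i) * of_real (r i))"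
    by (simp add: sampled_vec_def herm_adjoint)
  then show ?thesis by (simp add: herm_def discrete_inner_def power2_eq_square mult_ac)
qed

text \<open>Unitarity gives \<open>M ** conj_mat U = U ** diag_mat lam\<close>, and the weights
  \<open>r i\<close>, being real, survive the conjugation.\<close>

lemma antilinear_sampled: "M *v conj_vec (V f) = V (\<lambda>z. z * cnj (f z))"
proof -
  have "M ** conj_mat U = U ** (adjoint_mat U ** M ** conj_mat U)"
    using U by (simp add: unitary_mat_def matrix_mul_assoc)
  then have "M *v conj_vec (V f) = U *v (diag_mat lam *v conj_vec (\<chi> i. f (lam i) * of_real (r i)))"
    by (simp add: sampled_vec_def conj_vec_mult matrix_vector_mul_assoc D)
  also have "diag_mat lam *v conj_vec (\<chi> i. f (lam i) * of_real (r i))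
      = (\<chi> i. lam i * cnj (f (lam i)) * of_real (r i))"
    by (simp add: vec_eq_iff matrix_vector_mult_def diag_mat_def conj_vec_def
        if_distrib[of "\<lambda>x. x * _"] cong: if_cong)
  finally show ?thesis by (simp add: sampled_vec_def)
qed

lemma sampled_diff: "V f - V g = V (\<lambda>z. f z - g z)"
  unfolding sampled_vec_def matrix_vector_mult_diff_distrib[symmetric]
  by (rule arg_cong[of _ _ "(*v) U"]) (simp add: vec_eq_iff algebra_simps)

lemma sampled_scale: "c *s V f = V (\<lambda>z. c * f z)"
  unfolding sampled_vec_def vec.scale
  by (simp add: vec_eq_iff matrix_vector_mult_def sum_distrib_left mult_ac)

lemma sampled_scaleR: "c *\<^sub>R V f = V (\<lambda>z. of_real c * f z)"
  unfolding sampled_scale[symmetric] vec_eq_iff vector_scaleR_component vector_smult_component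
  by (simp add: scaleR_conv_of_real)

lemma sampled_one: "V (\<lambda>z. 1) = b"
proof -
  have "U *v (adjoint_mat U *v b) = b"
    using U by (simp add: unitary_mat_def matrix_vector_mul_assoc)
  then show ?thesis by (simp add: sampled_vec_def b)
qed

private abbreviation (input) "al \<equiv> lanczos_alpha M b"
private abbreviation (input) "be \<equiv> lanczos_beta M b"
private abbreviation (input) "p \<equiv> recurrence_fun al be"
private abbreviation (input) "w \<equiv> recurrence_num al be"
private abbreviation (input) "ip \<equiv> discrete_inner lam r"

text \<open>
  Both the Lanczos vectors and the recurrence use the junk convention \<open>x / 0 = 0\<close>, so their
  correspondence needs no assumption on breakdown.
\<close>
lemma lanczos_sampled:
  "lanczos_q M b (Suc k) = V (p k) \<and> lanczos_w M b (Suc k) = V (w k)"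
proof (induction k)
  case 0
  have p0: "p 0 = (\<lambda>z. 1)" by (simp add: fun_eq_iff)
  have q: "lanczos_q M b (Suc 0) = V (p 0)" unfolding p0 sampled_one by simp
  have w: "lanczos_w M b (Suc 0) = M *v conj_vec (lanczos_q M b (Suc 0)) - al (Suc 0) *s lanczos_q M b (Suc 0)"
    by (simp only: lanczos_w.simps(2) lanczos_alpha_def)
  have "lanczos_w M b (Suc 0) = V (w 0)"
    unfolding w q antilinear_sampled sampled_scale sampled_diff
    by (rule arg_cong[of _ _ V]) (simp add: fun_eq_iff recurrence_num_def)
  with q show ?case by blast
next
  case (Suc k)
  have q: "lanczos_q M b (Suc (Suc k)) = V (p (Suc k))"
    unfolding lanczos_step(2) conjunct2[OF Suc] sampled_scaleR
    by (rule arg_cong[of _ _ V])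
      (auto simp: fun_eq_iff recurrence_fun_Suc field_simps)
  have "lanczos_w M b (Suc (Suc k)) = V (w (Suc k))"
    unfolding lanczos_step(1) q conjunct1[OF Suc] antilinear_sampled sampled_scale sampled_scaleR sampled_diff
    by (rule arg_cong[of _ _ V]) (simp add: fun_eq_iff recurrence_num_def)
  with q show ?case by blast
qed

lemma lanczos_beta_inner: "of_real ((be (Suc k))\<^sup>2) = ip (w k) (w k)"
  using lanczos_sampled[of k] by (simp add: lanczos_beta_def herm_self[symmetric] herm_sampled del: of_real_power)

text \<open>Once \<open>p k\<close> is normalized, subtracting this multiple of it from
  \<open>z * cnj (p k z)\<close> removes the component along \<open>p k\<close>.\<close>

lemma lanczos_alpha_inner: "al (Suc k) = ip (\<lambda>z. z * cnj (p k z)) (p k)"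
  using lanczos_sampled[of k] by (simp add: lanczos_alpha_def antilinear_sampled herm_sampled)

end

section \<open>Orthogonality from the three term recurrence\<close>

lemma discrete_inner_cnj_swap:
  "discrete_inner lam r (\<lambda>z. z * cnj (f z)) g = discrete_inner lam r (\<lambda>z. z * cnj (g z)) f"
  by (simp add: discrete_inner_def mult_ac)

lemma discrete_inner_hermitian: "discrete_inner lam r f g = cnj (discrete_inner lam r g f)"
  by (simp add: discrete_inner_def mult_ac)

lemma discrete_inner_add: "discrete_inner lam r (\<lambda>z. f z + g z) h = discrete_inner lam r f h + discrete_inner lam r g h"
  and discrete_inner_diff: "discrete_inner lam r (\<lambda>z. f z - g z) h = discrete_inner lam r f h - discrete_inner lam r g h"
  and discrete_inner_scale: "discrete_inner lam r (\<lambda>z. c * f z) h = c * discrete_inner lam r f h"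
  and discrete_inner_zero: "discrete_inner lam r (\<lambda>z. 0) h = 0"
  by (simp_all add: discrete_inner_def sum.distrib sum_subtractf sum_distrib_left algebra_simps)

lemma discrete_inner_scale_right: "discrete_inner lam r f (\<lambda>z. c * g z) = cnj c * discrete_inner lam r f g"
  by (simp add: discrete_inner_def sum_distrib_left algebra_simps)

text \<open>
  The form \<open>\<langle>z \<cdot> cnj f, g\<rangle>\<close> is symmetric in \<open>f\<close> and \<open>g\<close>, which
  makes the three-term recurrence suffice for orthogonality to all earlier functions.
\<close>
lemma recurrence_num_orthogonal:
  fixes lam :: "'n::finite \<Rightarrow> complex" and r :: "'n \<Rightarrow> real" and al be
  defines "p \<equiv> recurrence_fun al be"
  assumes be: "\<And>i. 1 \<le> i \<Longrightarrow> i \<le> k \<Longrightarrow> be i \<noteq> 0"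
    and al: "al (Suc k) = discrete_inner lam r (\<lambda>z. z * cnj (p k z)) (p k)"
    and orth: "\<And>i j. i \<le> k \<Longrightarrow> j \<le> k \<Longrightarrow> discrete_inner lam r (p i) (p j) = (if i = j then 1 else 0)"
    and j: "j \<le> k"
  shows "discrete_inner lam r (recurrence_num al be k) (p j) = 0"
proof -
  let ?ip = "discrete_inner lam r"
  \<comment> \<open>The index is a parameter because the recurrence is used both at \<open>k\<close>
    and, solved for \<open>z * cnj (p j z)\<close>, at an earlier \<open>j\<close>.\<close>
  define prev where "prev = (\<lambda>k z. case k of 0 \<Rightarrow> 0 | Suc j \<Rightarrow> of_real (be k) * p j z)"
  have prev: "?ip (prev i) (p l) = (if i = Suc l then of_real (be i) else 0)" if "i \<le> k" "l \<le> k" for i l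
    using that orth by (cases i) (auto simp: prev_def discrete_inner_zero discrete_inner_scale)
  have num: "recurrence_num al be i = (\<lambda>z. z * cnj (p i z) - al (Suc i) * p i z - prev i z)" for i
    unfolding recurrence_num_def prev_def p_def by (rule refl)
  have w: "?ip (recurrence_num al be k) (p j)
      = ?ip (\<lambda>z. z * cnj (p k z)) (p j) - al (Suc k) * ?ip (p k) (p j) - ?ip (prev k) (p j)"
    unfolding num by (simp add: discrete_inner_diff discrete_inner_scale)
  show ?thesis
  proof (cases "j = k")
    case True
    then show ?thesis using w al orth[of k k] prev[of k k] by simp
  next
    case False
    then have jk: "Suc j \<le> k" using j by simp
    \<comment> \<open>Paired with \<open>p k\<close>, this expansion contributes only if
      \<open>Suc j = k\<close>, with value \<open>be k\<close>; after the swap of \<open>p j\<close>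
      and \<open>p k\<close> that is exactly what \<open>prev k\<close> subtracts.\<close>
    have "z * cnj (p j z) = of_real (be (Suc j)) * p (Suc j) z + (al (Suc j) * p j z + prev j z)" for z
      using be[of "Suc j"] jk
      by (simp add: p_def recurrence_fun_Suc) (simp add: num p_def)
    then have "?ip (\<lambda>z. z * cnj (p j z)) (p k)
        = of_real (be (Suc j)) * ?ip (p (Suc j)) (p k) + (al (Suc j) * ?ip (p j) (p k) + ?ip (prev j) (p k))"
      by (simp add: discrete_inner_add discrete_inner_scale)
    also have "\<dots> = (if k = Suc j then of_real (be k) else 0)"
      using orth[of "Suc j" k] orth[of j k] prev[of j k] jk by auto
    finally show ?thesis
      unfolding w using orth[of k j] prev[of k j] jk
      by (simp add: discrete_inner_cnj_swap[of lam r "p k"])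
  qed
qed

section \<open>No breakdown, orthonormality and spans, by induction on the step\<close>

theorem mainTheorem4:
  fixes M U :: "complex^'n^'n" and b :: "complex^'n"
    and lam :: "'n \<Rightarrow> complex" and r :: "'n \<Rightarrow> real"
  assumes "transpose M = M"
    and "norm b = 1"
    and "unitary_mat U"
    and "adjoint_mat U ** M ** conj_mat U = diag_mat lam"
    and "adjoint_mat U *v b = (\<chi> k. of_real (r k))"
    and "inj lam"
    and "\<And>i j k. \<lbrakk>i \<noteq> j; j \<noteq> k; i \<noteq> k; lam i \<noteq> 0; lam j \<noteq> 0; lam k \<noteq> 0\<rbrakk>
           \<Longrightarrow> \<not> (norm (lam i) = norm (lam j) \<and> norm (lam j) = norm (lam k))"
    and "card {k. lam k = 0} \<le> 1"
    and "\<And>k. r k > 0"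
  defines "n \<equiv> CARD('n)"
    and "p \<equiv> recurrence_fun (lanczos_alpha M b) (lanczos_beta M b)"
  shows "no_breakdown_before n M b
    \<and> symmetric_entries n (lanczos_T M b)
    \<and> tridiagonal_entries n (lanczos_T M b)
    \<and> (\<forall>k\<in>{1..n}. lanczos_T M b k k = lanczos_alpha M b k)
    \<and> (\<forall>k\<in>{1..<n}. lanczos_T M b k (k+1) = of_real (lanczos_beta M b k)
         \<and> lanczos_beta M b k > 0)
    \<and> (\<forall>j<n. cfun.span (p ` {..j}) = P_r2 j)
    \<and> (\<forall>k<n. \<forall>l<n. discrete_inner lam r (p k) (p l) = (if k = l then 1 else 0))"
proof -
  let ?al = "lanczos_alpha M b" and ?be = "lanczos_beta M b" and ?ip = "discrete_inner lam r"
  note data = assms(3-5)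
  \<comment> \<open>Both claims go through one induction: normalizing \<open>p (Suc k)\<close> needs
    \<open>?be (Suc k)\<close> nonzero, which rests on the earlier \<open>?be i\<close> through the
    leading coefficient.\<close>
  have main: "(\<forall>i\<in>{1..k}. ?be i \<noteq> 0) \<and> (\<forall>i\<le>k. \<forall>j\<le>k. ?ip (p i) (p j) = (if i = j then 1 else 0))"
    if "k < n" for k
    using that
  proof (induction k)
    case 0
    have "p 0 = (\<lambda>z. 1)" by (simp add: p_def fun_eq_iff)
    then have "?ip (p 0) (p 0) = herm b b"
      using herm_sampled[OF data, where f = "\<lambda>z. 1" and g = "\<lambda>z. 1"] sampled_one[OF data] by simp
    then show ?case using assms(2) by (simp add: herm_self)
  next
    case (Suc k)
    let ?w = "recurrence_num ?al ?be k"
    have be: "?be i \<noteq> 0" if "1 \<le> i" "i \<le> k" for i using Suc that by auto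
    have orth: "?ip (p i) (p j) = (if i = j then 1 else 0)" if "i \<le> k" "j \<le> k" for i j
      using Suc that by auto
    have "\<exists>c. c (Suc k) \<noteq> 0 \<and> ?w = r2_comb (Suc (Suc k)) c"
    proof (rule recurrence_num_leading)
      show "\<exists>d. recurrence_fun ?al ?be i = r2_comb (Suc i) d" if "k = Suc i" for i
        using recurrence_fun_leading[of i ?be ?al] be that by force
    qed (use recurrence_fun_leading[of k ?be ?al] be in blast)
    then obtain c where c: "c (Suc k) \<noteq> 0" "?w = r2_comb (Suc (Suc k)) c" by blast
    \<comment> \<open>The numerator combines the first \<open>Suc (Suc k)\<close> monomials, at most
      \<open>n\<close> since \<open>Suc k < n\<close>, so it cannot vanish on the whole
      spectrum.\<close>
    obtain m where m: "?w (lam m) \<noteq> 0"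
      using r2_comb_not_all_roots[OF assms(6,7), of "Suc (Suc k)" "Suc k" c] c Suc.prems n_def by auto
    have w_inner: "of_real ((?be (Suc k))\<^sup>2) = ?ip ?w ?w"
      by (rule lanczos_beta_inner[OF data])
    also have "\<dots> = of_real (\<Sum>i\<in>UNIV. (norm (?w (lam i)) * r i)\<^sup>2)"
      by (simp add: discrete_inner_def complex_norm_square[symmetric] power_mult_distrib)
    finally have "(?be (Suc k))\<^sup>2 = (\<Sum>i\<in>UNIV. (norm (?w (lam i)) * r i)\<^sup>2)"
      unfolding of_real_eq_iff .
    \<comment> \<open>Positivity of \<open>r m\<close> ensures that the nonzero value at
      \<open>lam m\<close> is seen by the inner product.\<close>
    moreover have "(\<Sum>i\<in>UNIV. (norm (?w (lam i)) * r i)\<^sup>2) > 0"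
      using m assms(9)[of m] by (intro sum_pos2[of _ m]) auto
    ultimately have be_Suc: "?be (Suc k) \<noteq> 0" by auto
    have w_orth: "?ip ?w (p j) = 0" if "j \<le> k" for j
      unfolding p_def using that be orth[unfolded p_def] lanczos_alpha_inner[OF data]
      by (intro recurrence_num_orthogonal) auto
    have p_Suc: "p (Suc k) = (\<lambda>z. inverse (of_real (?be (Suc k))) * ?w z)"
      by (simp add: p_def fun_eq_iff recurrence_fun_Suc divide_inverse mult.commute)
    have zero: "?ip (p (Suc k)) (p j) = 0" "?ip (p j) (p (Suc k)) = 0" if "j \<le> k" for j
      using w_orth[OF that] discrete_inner_hermitian[of lam r "p j"]
      by (simp_all add: p_Suc discrete_inner_scale)
    have one: "?ip (p (Suc k)) (p (Suc k)) = 1"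
      unfolding p_Suc discrete_inner_scale discrete_inner_scale_right w_inner[symmetric]
      using be_Suc by (simp add: power2_eq_square field_simps)
    show ?case
      using be be_Suc orth zero one by (auto simp: le_Suc_eq)
  qed
  have be: "?be k \<noteq> 0" if "1 \<le> k" "k < n" for k
    using main[of k] that by auto
  then have be_pos: "?be k > 0" if "1 \<le> k" "k < n" for k
    using that by (simp add: lanczos_beta_def)
  have span: "cfun.span (p ` {..j}) = P_r2 j" if "j < n" for j
  proof -
    have "cfun.span (p ` {..<Suc j}) = cfun.span (r2_monomial ` {..<Suc j})"
      unfolding p_def using be that by (intro span_triangular recurrence_fun_leading) auto
    then show ?thesis by (simp add: lessThan_Suc_atMost P_r2_eq span_r2_monomial[symmetric])
  qed
  have orth: "?ip (p k) (p l) = (if k = l then 1 else 0)" if "k < n" "l < n" for k l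
    using main[of "max k l"] that by auto
  show ?thesis
    using be be_pos span orth
    by (auto simp: no_breakdown_before_def symmetric_entries_def tridiagonal_entries_def lanczos_T_def)
qed

end
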